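(* Let $X$ be a first countable topological space in which every closed subset is separable, let $x=(x_n)_{n\ge 1}$ be a sequence taking values in $X$, and let $\mathcal{I}$ be an ideal on $\mathbf{N}$ which is $F_\sigma$-separated from its dual filter (in particular, $\mathcal{I}$ can be any $F_{\sigma\delta}$-ideal). Then the set $$\{\omega\in(0,1]: \Gamma_{x\upharpoonright\omega}(\mathcal{I})=\Gamma_x(\mathcal{I})\}$$ is not meager if and only if $\Gamma_x(\mathcal{I})=\mathrm{L}_x$. Moreover, in this case, it is comeager.
   Context: $\mathbf{N}$ is the set of positive integers. An ideal on $\mathbf{N}$ is a family $\mathcal{I}\subseteq\mathcal{P}(\mathbf{N})$ closed under finite unions and subsets, with $\mathbf{N}\notin\mathcal{I}$ and containing the family $\mathrm{Fin}$ of all finite subsets of $\mathbf{N}$. $\mathcal{P}(\mathbf{N})$ carries the Cantor-space topology (sets identified with their characteristic functions in $\{0,1\}^{\mathbf{N}}$); "$F_\sigma$", "$F_{\sigma\delta}$" refer to this topology. The dual filter is $\mathcal{I}^\star=\{S\subseteq\mathbf{N}: \mathbf{N}\setminus S\in\mathcal{I}\}$. $\mathcal{I}$ is $F_\sigma$-separated from its dual filter if there is an $F_\sigma$-set $A\subseteq\mathcal{P}(\mathbf{N})$ with $\mathcal{I}\subseteq A$ and $A\cap\mathcal{I}^\star=\emptyset$. For a sequence $x=(x_n)$ in $X$, $\Gamma_x(\mathcal{I})$ is the set of $\mathcal{I}$-cluster points of $x$: all $\ell\in X$ such that $\{n: x_n\in U\}\notin\mathcal{I}$ for every neighborhood $U$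 of $\ell$. $\mathrm{L}_x$ is the set of ordinary limit points of $x$: all $\ell\in X$ such that some subsequence of $x$ converges to $\ell$. For $\omega\in(0,1]$ let $\sum_{i\ge1}d_i(\omega)2^{-i}$ be its unique non-terminating dyadic expansion, $d_i(\omega)\in\{0,1\}$ (infinitely many digits equal to $1$). If $n_1<n_2<\cdots$ enumerates $\{i: d_i(\omega)=1\}$, then $x\upharpoonright\omega$ denotes the subsequence $(x_{n_k})_{k\ge1}$, regarded as a sequence indexed by $k\in\mathbf{N}$. Meager (first category) and comeager (complement of a meager set) refer to $(0,1]$ with its usual topology. *)

theory Defs
  imports "HOL-Analysis.Analysis"
begin

section \<open>Ideals on the positive integers\<close>

text \<open>The set of positive integers is rendered as the subset \<open>{1..}\<close> of \<^typ>\<open>nat\<close>.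
  Sequences indexed by it are functions on \<^typ>\<open>nat\<close> whose value at \<open>0\<close> is never used.\<close>

abbreviation pos_ints :: "nat set" where
  "pos_ints \<equiv> {1..}"

definition ideal_on_pos_ints :: "nat set set \<Rightarrow> bool" where
  "ideal_on_pos_ints \<I> \<longleftrightarrow>
     \<I> \<subseteq> Pow pos_ints \<and>
     (\<forall>A\<in>\<I>. \<forall>B\<in>\<I>. A \<union> B \<in> \<I>) \<and>
     (\<forall>A\<in>\<I>. \<forall>B. B \<subseteq> A \<longrightarrow> B \<in> \<I>) \<and>
     pos_ints \<notin> \<I> \<and>
     (\<forall>A. A \<subseteq> pos_ints \<and> finite A \<longrightarrow> A \<in> \<I>)"

definition dual_filter :: "nat set set \<Rightarrow> nat set set" where
  "dual_filter \<I> = {S. S \<subseteq> pos_ints \<and> pos_ints - S \<in> \<I>}"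

text \<open>The topology on the power set of the positive integers obtained by identifying a set with
  its characteristic function in the product of discrete two-point spaces. Elements of the
  product topology are extensional functions, hence the \<^const>\<open>restrict\<close>.\<close>

definition cantor_powerset :: "nat set topology" where
  "cantor_powerset =
     pullback_topology (Pow pos_ints) (\<lambda>S. restrict (\<lambda>n. n \<in> S) pos_ints)
       (product_topology (\<lambda>_. discrete_topology (UNIV :: bool set)) pos_ints)"

definition fsigma_delta_in :: "'a topology \<Rightarrow> 'a set \<Rightarrow> bool" where
  "fsigma_delta_in X = (countable intersection_of fsigma_in X) relative_to topspace X"

definition fsigma_separated :: "nat set set \<Rightarrow> bool" where
  "fsigma_separated \<I> \<longleftrightarrow>
     (\<exists>A. fsigma_in cantor_powerset A \<and> \<I> \<subseteq> A \<and> A \<inter> dual_filter \<I> = {})"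


section \<open>Cluster points and limit points\<close>

definition ideal_cluster_points ::
    "'a topology \<Rightarrow> nat set set \<Rightarrow> (nat \<Rightarrow> 'a) \<Rightarrow> 'a set" where
  "ideal_cluster_points X \<I> x =
     {l \<in> topspace X. \<forall>U. openin X U \<and> l \<in> U \<longrightarrow> {n \<in> pos_ints. x n \<in> U} \<notin> \<I>}"

definition ordinary_limit_points :: "'a topology \<Rightarrow> (nat \<Rightarrow> 'a) \<Rightarrow> 'a set" where
  "ordinary_limit_points X x =
     {l \<in> topspace X. \<exists>r :: nat \<Rightarrow> nat. strict_mono r \<and> range r \<subseteq> pos_ints \<and>
        limitin X (x \<circ> r) l sequentially}"


section \<open>Nonterminating dyadic expansions and subsequences\<close>

text \<open>Only the digits at positive positions matter; the condition \<open>d 0 = 0\<close> fixes the irrelevant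
  value so that the expansion is unique as a function on \<^typ>\<open>nat\<close>.\<close>

definition nonterminating_dyadic :: "real \<Rightarrow> (nat \<Rightarrow> nat) \<Rightarrow> bool" where
  "nonterminating_dyadic \<omega> d \<longleftrightarrow>
     d 0 = 0 \<and> (\<forall>i\<in>pos_ints. d i \<in> {0, 1}) \<and> infinite {i \<in> pos_ints. d i = 1} \<and>
     (\<lambda>i. real (d (Suc i)) / 2 ^ Suc i) sums \<omega>"

definition dyadic_digit :: "real \<Rightarrow> nat \<Rightarrow> nat" where
  "dyadic_digit \<omega> = (THE d. nonterminating_dyadic \<omega> d)"

lemma nonterminating_dyadic_unique:
  assumes d: "nonterminating_dyadic \<omega> d" and e: "nonterminating_dyadic \<omega> e"
  shows "d = e"
proof (rule ccontr)
  have False if d: "nonterminating_dyadic \<omega> d" and e: "nonterminating_dyadic \<omega> e"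
    and i: "\<And>j. j < i \<Longrightarrow> d j = e j" and lt: "d i < e i" for d e i
  proof -
    have d01: "b j \<le> 1" if "nonterminating_dyadic \<omega> b" for b j
    proof (cases "j = 0")
      case True
      with that show ?thesis by (simp add: nonterminating_dyadic_def)
    next
      case False
      then have "j \<in> pos_ints" by simp
      with that have "b j \<in> {0, 1}" unfolding nonterminating_dyadic_def by blast
      then show ?thesis by auto
    qed
    note d01 = d01[OF d] d01[OF e]
    have "d 0 = e 0" using d e unfolding nonterminating_dyadic_def by simp
    with lt obtain m where m: "i = Suc m" by (cases i) auto
    have di: "d i = 0" "e i = 1" using lt d01(1)[of i] d01(2)[of i] by linarith+
    define f where "f = (\<lambda>j. (real (e (Suc j)) - real (d (Suc j))) / 2 ^ Suc j)"
    have "(\<lambda>j. real (e (Suc j)) / 2 ^ Suc j - real (d (Suc j)) / 2 ^ Suc j) sums (\<omega> - \<omega>)"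
      using d e unfolding nonterminating_dyadic_def by (intro sums_diff) auto
    then have "f sums 0" unfolding f_def by (simp add: diff_divide_distrib)
    then have "(\<lambda>j. f (j + Suc m)) sums (0 - sum f {..<Suc m})"
      by (subst sums_iff_shift) simp
    moreover have sf: "sum f {..<Suc m} = 1 / 2 ^ Suc m"
      using i di m by (simp add: f_def)
    ultimately have 1: "(\<lambda>j. f (j + Suc m)) sums (- (1 / 2 ^ Suc m))"
      unfolding sf diff_0 by simp
    have "(\<lambda>j. (1 / 2 ^ Suc m) * (1 / 2) ^ Suc j) sums ((1 / 2 ^ Suc m) * (1::real))"
      by (intro sums_mult power_half_series)
    from sums_add[OF this 1]
    have 2: "(\<lambda>j. (1 / 2 ^ Suc m) * (1 / 2) ^ Suc j + f (j + Suc m)) sums 0" by simp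
    have eq: "(1 / 2 ^ Suc m) * (1 / 2) ^ Suc j + f (j + Suc m) =
        (1 + real (e (Suc (j + Suc m))) - real (d (Suc (j + Suc m)))) / 2 ^ Suc (j + Suc m)" for j
      by (simp add: f_def field_simps power_add)
    have nn: "0 \<le> (1 / 2 ^ Suc m) * (1 / 2) ^ Suc j + f (j + Suc m)" for j
      unfolding eq using d01(1)[of "Suc (j + Suc m)"] by (intro divide_nonneg_pos) auto
    have "(1 / 2 ^ Suc m) * (1 / 2) ^ Suc j + f (j + Suc m) = 0" for j
      using suminf_eq_zero_iff[OF sums_summable[OF 2] nn] sums_unique[OF 2, symmetric] by simp
    then have zero: "1 + real (e (Suc (j + Suc m))) - real (d (Suc (j + Suc m))) = 0" for j
      unfolding eq by (metis divide_eq_0_iff power_not_zero zero_neq_numeral)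
    have z: "e (Suc (j + Suc m)) = 0" for j
    proof -
      have "real (1 + e (Suc (j + Suc m))) = real (d (Suc (j + Suc m)))" for j
        using zero[of j] by simp
      then have "1 + e (Suc (j + Suc m)) = d (Suc (j + Suc m))" for j
        unfolding of_nat_eq_iff .
      with d01(1)[of "Suc (j + Suc m)"] show ?thesis
        by (metis add_leD1 add_le_same_cancel1 le_zero_eq)
    qed
    have "{j \<in> pos_ints. e j = 1} \<subseteq> {..Suc m}"
    proof (rule subsetI, rule ccontr)
      fix j assume j: "j \<in> {j \<in> pos_ints. e j = 1}" "j \<notin> {..Suc m}"
      then have "e (Suc ((j - Suc (Suc m)) + Suc m)) = 0" using z by blast
      moreover have "Suc ((j - Suc (Suc m)) + Suc m) = j" using j(2) by simp
      ultimately have "e j = 0" by metis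
      with j(1) show False by simp
    qed
    then have "finite {j \<in> pos_ints. e j = 1}" using finite_subset by blast
    with e show False unfolding nonterminating_dyadic_def by blast
  qed
  note * = this
  assume "d \<noteq> e"
  then obtain k where "d k \<noteq> e k" by auto
  define i where "i = (LEAST k. d k \<noteq> e k)"
  have i: "d i \<noteq> e i" "\<And>j. j < i \<Longrightarrow> d j = e j"
    unfolding i_def using LeastI[of "\<lambda>k. d k \<noteq> e k", OF \<open>d k \<noteq> e k\<close>] not_less_Least by blast+
  from i(1) consider "d i < e i" | "e i < d i" by linarith
  then show False
    using *[OF d e i(2)] *[OF e d i(2)[symmetric]] by cases auto
qed

lemma nonterminating_dyadic_exists:
  assumes "0 < \<omega>" "\<omega> \<le> 1"
  shows "\<exists>d. nonterminating_dyadic \<omega> d"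
proof -
  define c where "c n = \<lceil>2 ^ n * \<omega>\<rceil> - 1" for n :: nat
  define d where "d i = (if i = 0 then 0 else nat (c i - 2 * c (i - 1)))" for i
  have c: "real_of_int (c n) < 2 ^ n * \<omega>" "2 ^ n * \<omega> \<le> real_of_int (c n) + 1" for n
    unfolding c_def by (simp_all, linarith+)
  have c01: "c (Suc n) - 2 * c n \<in> {0, 1}" for n
  proof -
    have "real_of_int (c (Suc n)) < 2 * (real_of_int (c n) + 1)"
      "2 * real_of_int (c n) < real_of_int (c (Suc n)) + 1"
      using c[of n] c[of "Suc n"] by (auto simp: mult.assoc)
    then have "real_of_int (c (Suc n)) < real_of_int (2 * (c n + 1))"
      "real_of_int (2 * c n) < real_of_int (c (Suc n) + 1)" by simp_all
    then have "c (Suc n) < 2 * (c n + 1)" "2 * c n < c (Suc n) + 1"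
      unfolding of_int_less_iff .
    then show ?thesis by auto
  qed
  have d: "real (d (Suc n)) = real_of_int (c (Suc n)) - 2 * real_of_int (c n)" for n
    using c01[of n] unfolding d_def by auto
  have "\<lceil>\<omega>\<rceil> = 1" using assms by (simp add: ceiling_eq_iff)
  then have c0: "c 0 = 0" by (simp add: c_def)
  have part: "(\<Sum>i<n. real (d (Suc i)) / 2 ^ Suc i) = real_of_int (c n) / 2 ^ n" for n
    by (induction n) (auto simp: c0 d field_simps)
  have "(\<lambda>n. real_of_int (c n) / 2 ^ n) \<longlonglongrightarrow> \<omega>"
  proof (rule tendsto_sandwich)
    show "(\<lambda>n. \<omega> - (1 / 2) ^ n) \<longlonglongrightarrow> \<omega>"
      using tendsto_diff[OF tendsto_const[of \<omega>] LIMSEQ_power_zero[of "1/2::real"]] by simp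
    show "\<forall>\<^sub>F n in sequentially. \<omega> - (1 / 2) ^ n \<le> real_of_int (c n) / 2 ^ n"
    proof (intro always_eventually allI)
      fix n
      have "\<omega> \<le> (real_of_int (c n) + 1) / 2 ^ n"
        using c(2)[of n] by (simp add: pos_le_divide_eq mult.commute)
      then show "\<omega> - (1 / 2) ^ n \<le> real_of_int (c n) / 2 ^ n"
        by (simp add: add_divide_distrib power_one_over)
    qed
    show "\<forall>\<^sub>F n in sequentially. real_of_int (c n) / 2 ^ n \<le> \<omega>"
      using c(1) by (intro always_eventually allI) (simp add: field_simps less_imp_le)
  qed simp
  then have sums: "(\<lambda>i. real (d (Suc i)) / 2 ^ Suc i) sums \<omega>"
    unfolding sums_def part .
  have d01: "d i \<in> {0, 1}" for i
    using c01[of "i - 1"] unfolding d_def by auto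
  have "infinite {i \<in> pos_ints. d i = 1}"
  proof
    assume "finite {i \<in> pos_ints. d i = 1}"
    then obtain m where m: "\<And>i. i \<in> {i \<in> pos_ints. d i = 1} \<Longrightarrow> i < m"
      using finite_nat_set_iff_bounded by auto
    have "(\<lambda>i. real (d (Suc i)) / 2 ^ Suc i) sums (\<Sum>i<m. real (d (Suc i)) / 2 ^ Suc i)"
    proof (rule sums_finite)
      fix i assume "i \<notin> {..<m}"
      then have "d (Suc i) \<noteq> 1" using m[of "Suc i"] by auto
      then show "real (d (Suc i)) / 2 ^ Suc i = 0" using d01[of "Suc i"] by auto
    qed simp
    then have "\<omega> = real_of_int (c m) / 2 ^ m" using sums sums_unique2 part by metis
    with c(1)[of m] show False by (simp add: field_simps)
  qed
  moreover have "d 0 = 0" by (simp add: d_def)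
  ultimately have "nonterminating_dyadic \<omega> d"
    using sums d01 unfolding nonterminating_dyadic_def by blast
  then show ?thesis by blast
qed

lemma nonterminating_dyadic_digit:
  assumes "\<omega> \<in> {0<..1}"
  shows "nonterminating_dyadic \<omega> (dyadic_digit \<omega>)"
proof -
  obtain d where "nonterminating_dyadic \<omega> d"
    using assms nonterminating_dyadic_exists by auto
  then show ?thesis
    unfolding dyadic_digit_def using nonterminating_dyadic_unique theI[of "nonterminating_dyadic \<omega>" d]
    by blast
qed

text \<open>The function \<^const>\<open>enumerate\<close> counts from \<open>0\<close>, so the \<open>k\<close>-th element of the support
  for \<open>k \<ge> 1\<close> is the one with number \<open>k - 1\<close>.\<close>

definition dyadic_subseq :: "(nat \<Rightarrow> 'a) \<Rightarrow> real \<Rightarrow> nat \<Rightarrow> 'a" where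
  "dyadic_subseq x \<omega> k = x (enumerate {i \<in> pos_ints. dyadic_digit \<omega> i = 1} (k - 1))"


section \<open>Baire category\<close>

definition nowhere_dense_in :: "'a topology \<Rightarrow> 'a set \<Rightarrow> bool" where
  "nowhere_dense_in X S \<longleftrightarrow> S \<subseteq> topspace X \<and> X interior_of (X closure_of S) = {}"

definition meager_in :: "'a topology \<Rightarrow> 'a set \<Rightarrow> bool" where
  "meager_in X = countable union_of nowhere_dense_in X"

definition comeager_in :: "'a topology \<Rightarrow> 'a set \<Rightarrow> bool" where
  "comeager_in X S \<longleftrightarrow> S \<subseteq> topspace X \<and> meager_in X (topspace X - S)"

end

theory Submission
  imports Defs
begin

text \<open>Why the dichotomy holds. A cluster point of a subsequence is always a limit point of \<open>x\<close>
(\<open>ideal_cluster_points_dyadic_subseq_subset\<close>), so subsequences have all their cluster points in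
the set \<open>L\<close> of limit points of \<open>x\<close>, and for generic subsequences they fill \<open>L\<close>. Indeed, let \<open>l\<close> be a limit
point of \<open>x\<close>, \<open>U\<close> a neighborhood of \<open>l\<close>, and \<open>S\<close> the infinite set of all \<open>n\<close> with \<open>x n \<in> U\<close>. After an
arbitrary finite beginning, a subsequence may continue with indices in \<open>S\<close> only, and then the
positions of its terms in \<open>U\<close> form a set of the dual filter. If an \<open>F\<^sub>\<sigma>\<close>-set covers \<open>\<I>\<close> and misses
the dual filter, then each of its closed pieces is avoided after finitely many steps of such a
continuation. Hence the \<open>\<omega>\<close> for which those positions form a set in \<open>\<I>\<close> are covered by countably
many nowhere dense sets (\<open>meager_indices_in_ideal\<close>), and by first countability the \<open>\<omega>\<close> for which
\<open>l\<close> is not a cluster point of the subsequence form a meager set (\<open>meager_limit_point_not_cluster\<close>).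

If the cluster points of \<open>x\<close> are exactly \<open>L\<close>, apply this to a countable dense subset of \<open>L\<close>. As cluster
point sets are closed, comeagerly many subsequences have the cluster point set \<open>L\<close>, and a comeager
set is not meager by the Baire category theorem. Conversely, if a nonmeager set of subsequences
has the same cluster points as \<open>x\<close>, then for each \<open>l \<in> L\<close> one of them has \<open>l\<close> as a cluster
point, so that \<open>l\<close> is a cluster point of \<open>x\<close>.

That every \<open>F\<^sub>\<sigma>\<^sub>\<delta>\<close>-ideal is \<open>F\<^sub>\<sigma>\<close>-separated from its dual filter is shown by contradiction
(\<open>fsigma_delta_ideal_separated\<close>). If \<open>\<I>\<close> is the intersection of \<open>F\<^sub>\<sigma>\<close>-sets \<open>F n\<close> and is not
separated, then a Baire category argument, applied to power sets of members of \<open>\<I>\<close> and carried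
over to the dual filter by the lack of a separation (\<open>unseparated_capture\<close>), allows one to build
a set piece by piece such that both the set and its complement are in all \<open>F n\<close>. Both would be
in \<open>\<I>\<close>, and so would their union, the set of all positive integers.\<close>

section \<open>The Cantor topology in terms of initial segments\<close>

lemma topspace_cantor_powerset: "topspace cantor_powerset = Pow pos_ints"
  unfolding cantor_powerset_def topspace_pullback_topology by auto

lemma openin_cantor_powerset:
  "openin cantor_powerset V \<longleftrightarrow>
     V \<subseteq> Pow pos_ints \<and>
     (\<forall>B\<in>V. \<exists>q. \<forall>D\<subseteq>pos_ints. D \<inter> {..q} = B \<inter> {..q} \<longrightarrow> D \<in> V)"
    (is "_ = ?R")
proof -
  let ?f = "\<lambda>S. restrict (\<lambda>n. n \<in> S) pos_ints"
  let ?T = "product_topology (\<lambda>_. discrete_topology (UNIV :: bool set)) pos_ints"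
  have char: "openin cantor_powerset V \<longleftrightarrow> (\<exists>U. openin ?T U \<and> V = ?f -` U \<inter> Pow pos_ints)"
    unfolding cantor_powerset_def openin_pullback_topology ..
  show ?thesis
  proof
    assume "openin cantor_powerset V"
    then obtain U where U: "openin ?T U" and V: "V = ?f -` U \<inter> Pow pos_ints"
      unfolding char by blast
    show ?R
    proof (intro conjI ballI)
      fix B assume "B \<in> V"
      then have "?f B \<in> U" using V by simp
      then obtain Z where Z: "finite {i \<in> pos_ints. Z i \<noteq> (UNIV :: bool set)}"
        "?f B \<in> Pi\<^sub>E pos_ints Z" "Pi\<^sub>E pos_ints Z \<subseteq> U"
        using U[unfolded openin_product_topology_alt topspace_discrete_topology, rule_format,
          OF \<open>?f B \<in> U\<close>] by (elim exE conjE)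
      obtain q where q: "{i \<in> pos_ints. Z i \<noteq> UNIV} \<subseteq> {..q}"
        using Z(1) finite_nat_iff_bounded_le by blast
      have "D \<in> V" if D: "D \<subseteq> pos_ints" "D \<inter> {..q} = B \<inter> {..q}" for D
      proof -
        have "?f D \<in> Pi\<^sub>E pos_ints Z"
        proof (rule PiE_I)
          fix i assume i: "i \<in> pos_ints"
          show "?f D i \<in> Z i"
          proof (cases "i \<le> q")
            case True
            then have "i \<in> D \<longleftrightarrow> i \<in> B" using D(2) by blast
            then show ?thesis using PiE_mem[OF Z(2) i] i by simp
          next
            case False
            then have "i \<notin> {i \<in> pos_ints. Z i \<noteq> UNIV}" using q by (metis atMost_iff subsetD)
          then have "Z i = UNIV" using i by blast
            then show ?thesis by simp
          qed
        qed simp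
        then have "?f D \<in> U" using Z(3) by (rule rev_subsetD)
        then show ?thesis using V D(1) by blast
      qed
      then show "\<exists>q. \<forall>D\<subseteq>pos_ints. D \<inter> {..q} = B \<inter> {..q} \<longrightarrow> D \<in> V" by blast
    qed (use V in blast)
  next
    assume R: ?R
    define U where "U = {g \<in> Pi\<^sub>E pos_ints (\<lambda>_. UNIV). {n \<in> pos_ints. g n} \<in> V}"
    have "openin ?T U"
      unfolding openin_product_topology_alt topspace_discrete_topology
    proof
      fix g assume g: "g \<in> U"
      then obtain q where
        q: "\<And>D. D \<subseteq> pos_ints \<Longrightarrow> D \<inter> {..q} = {n \<in> pos_ints. g n} \<inter> {..q} \<Longrightarrow> D \<in> V"
        using R unfolding U_def by blast
      let ?Z = "\<lambda>i. if i \<le> q then {g i} else UNIV"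
      have "finite {i \<in> pos_ints. ?Z i \<noteq> UNIV}"
        by (rule finite_subset[of _ "{..q}"]) auto
      moreover have "g \<in> Pi\<^sub>E pos_ints ?Z" using g unfolding U_def PiE_def by auto
      moreover have "Pi\<^sub>E pos_ints ?Z \<subseteq> U"
      proof
        fix h assume h: "h \<in> Pi\<^sub>E pos_ints ?Z"
        have "h i = g i" if "i \<in> pos_ints" "i \<le> q" for i
          using PiE_mem[OF h that(1)] that(2) by simp
        then have "{n \<in> pos_ints. h n} \<inter> {..q} = {n \<in> pos_ints. g n} \<inter> {..q}" by auto
        from q[OF _ this] have "{n \<in> pos_ints. h n} \<in> V" by blast
        then show "h \<in> U" using h unfolding U_def by (auto simp: PiE_def)
      qed
      ultimately show "\<exists>Z. finite {i \<in> pos_ints. Z i \<noteq> UNIV} \<and>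
          (\<forall>i\<in>pos_ints. openin (discrete_topology UNIV) (Z i)) \<and>
          g \<in> Pi\<^sub>E pos_ints Z \<and> Pi\<^sub>E pos_ints Z \<subseteq> U"
        by (intro exI[of _ ?Z]) simp
    qed
    moreover have "V = ?f -` U \<inter> Pow pos_ints"
    proof -
      have pre: "{n \<in> pos_ints. ?f S n} = S" if "S \<subseteq> pos_ints" for S
        using that by auto
      have "?f S \<in> U \<longleftrightarrow> S \<in> V" if S: "S \<subseteq> pos_ints" for S
        unfolding U_def mem_Collect_eq pre[OF S] by simp
      moreover have "V \<subseteq> Pow pos_ints" using R ..
      ultimately show ?thesis by blast
    qed
    ultimately show "openin cantor_powerset V" unfolding char by blast
  qed
qed

lemma closedin_cantor_powerset:
  "closedin cantor_powerset C \<longleftrightarrow>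
     C \<subseteq> Pow pos_ints \<and>
     (\<forall>B\<subseteq>pos_ints. B \<notin> C \<longrightarrow> (\<exists>q. \<forall>D\<subseteq>pos_ints. D \<inter> {..q} = B \<inter> {..q} \<longrightarrow> D \<notin> C))"
  unfolding closedin_def topspace_cantor_powerset openin_cantor_powerset by auto

text \<open>Both fusion arguments below build a set as the union of a coherent sequence of approximations,
where \<open>s n\<close> decides membership on \<open>K n\<close> once and for all.\<close>

lemma Union_coherent_Int:
  fixes K s :: "nat \<Rightarrow> 'b set"
  assumes mono: "\<And>n. K n \<subseteq> K (Suc n)" and sub: "\<And>n. s n \<subseteq> K n"
    and coh: "\<And>n. s (Suc n) \<inter> K n = s n"
  shows "(\<Union>m. s m) \<inter> K n = s n"
proof -
  have K: "K m \<subseteq> K n" if "m \<le> n" for m n using mono that by (rule lift_Suc_mono_le)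
  have *: "s n \<inter> K m = s m" if "m \<le> n" for m n
    using that
  proof (induction n rule: dec_induct)
    case base
    then show ?case using sub by blast
  next
    case (step n)
    then have "s (Suc n) \<inter> K m = s (Suc n) \<inter> K n \<inter> K m" using K[of m n] by blast
    then show ?case using step coh by simp
  qed
  have "s m \<inter> K n \<subseteq> s n" for m
    using *[of n m] *[of m n] by (cases "m \<le> n") auto
  moreover have "s n \<subseteq> K n" by (rule sub)
  ultimately show ?thesis by auto
qed

text \<open>This is the Baire category theorem for the compact space of all \<open>u \<union> B\<close> with \<open>B \<subseteq> D\<close>: if
countably many closed sets cover it, one of them contains a relatively open piece, and the
prefix \<open>s\<close> describes that piece. If no piece were contained in any \<open>C k\<close>, one could leave the
sets \<open>C 0\<close>, \<open>C 1\<close>, \<dots> one after the other, each time by fixing a longer finite part of \<open>B\<close>, and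
the limit would lie in none of them.\<close>

lemma cylinder_in_closed_cover:
  assumes C: "\<And>k::nat. closedin cantor_powerset (C k)"
    and D: "D \<subseteq> pos_ints" and u: "u \<subseteq> pos_ints"
    and cover: "\<And>B. B \<subseteq> D \<Longrightarrow> u \<union> B \<in> (\<Union>k. C k)"
  shows "\<exists>k p s. s \<subseteq> D \<inter> {..p} \<and> (\<forall>B\<subseteq>D - {..p}. u \<union> s \<union> B \<in> C k)"
    (is ?goal)
proof (rule ccontr)
  assume neg: "\<not> ?goal"
  have escape: "\<exists>B\<subseteq>D - {..p}. u \<union> s \<union> B \<notin> C k" if "s \<subseteq> D \<inter> {..p}" for k p s
  proof (rule ccontr)
    assume "\<not> ?thesis"
    then have "\<forall>B\<subseteq>D - {..p}. u \<union> s \<union> B \<in> C k" by blast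
    with that have ?goal by (intro exI conjI)
    with neg show False ..
  qed
  \<comment> \<open>A state \<open>(s, p)\<close> records that the trace of the limit set on \<open>{..p}\<close> is \<open>s\<close>.\<close>
  define P where "P z \<longleftrightarrow> fst z \<subseteq> D \<inter> {..snd z}" for z :: "nat set \<times> nat"
  define Q where "Q k z z' \<longleftrightarrow> snd z \<le> snd z' \<and> fst z' \<inter> {..snd z} = fst z \<and>
      (\<forall>B\<subseteq>pos_ints. B \<inter> {..snd z'} = (u \<union> fst z') \<inter> {..snd z'} \<longrightarrow> B \<notin> C k)"
    for k and z z' :: "nat set \<times> nat"
  have "\<exists>z. \<forall>k. P (z k) \<and> Q k (z k) (z (Suc k))"
  proof (rule dependent_nat_choice)
    show "\<exists>z. P z" unfolding P_def by (intro exI[of _ "({}, 0)"]) simp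
  next
    fix z k assume "P z"
    then have z: "fst z \<subseteq> D \<inter> {..snd z}" unfolding P_def .
    from escape[OF z] obtain B where B: "B \<subseteq> D - {..snd z}" "u \<union> fst z \<union> B \<notin> C k" by blast
    have "u \<union> fst z \<union> B \<subseteq> pos_ints" using u D z B(1) by blast
    with C[of k] B(2) obtain q where
      q: "\<And>E. E \<subseteq> pos_ints \<Longrightarrow> E \<inter> {..q} = (u \<union> fst z \<union> B) \<inter> {..q} \<Longrightarrow> E \<notin> C k"
      unfolding closedin_cantor_powerset by blast
    define q' where "q' = max q (snd z)"
    define s' where "s' = fst z \<union> (B \<inter> {..q'})"
    have "s' \<subseteq> D \<inter> {..q'}" using z B(1) unfolding s'_def q'_def by fastforce
    moreover have "s' \<inter> {..snd z} = fst z" using z B(1) unfolding s'_def by auto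
    moreover have "E \<notin> C k"
      if E: "E \<subseteq> pos_ints" "E \<inter> {..q'} = (u \<union> s') \<inter> {..q'}" for E
    proof (rule q[OF E(1)])
      have "E \<inter> {..q} = E \<inter> {..q'} \<inter> {..q}" unfolding q'_def by auto
      also have "\<dots> = (u \<union> fst z \<union> B) \<inter> {..q}"
        unfolding E(2) s'_def unfolding q'_def by auto
      finally show "E \<inter> {..q} = (u \<union> fst z \<union> B) \<inter> {..q}" .
    qed
    moreover have "snd z \<le> q'" unfolding q'_def by simp
    ultimately show "\<exists>z'. P z' \<and> Q k z z'"
      unfolding P_def Q_def by (intro exI[of _ "(s', q')"]) simp
  qed
  then obtain z where P: "\<And>k. P (z k)" and Q: "\<And>k. Q k (z k) (z (Suc k))" by blast
  define s where "s k = fst (z k)" for k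
  define p where "p k = snd (z k)" for k
  define E where "E = (\<Union>k. s k)"
  have s: "s k \<subseteq> D \<inter> {..p k}" for k using P[of k] unfolding P_def s_def p_def .
  have E: "E \<inter> {..p k} = s k" for k
    unfolding E_def
  proof (rule Union_coherent_Int)
    show "{..p n} \<subseteq> {..p (Suc n)}" for n
      using Q[of n] unfolding Q_def p_def by simp
    show "s n \<subseteq> {..p n}" for n using s by blast
    show "s (Suc n) \<inter> {..p n} = s n" for n using Q[of n] unfolding Q_def s_def p_def by blast
  qed
  have ED: "E \<subseteq> D" unfolding E_def using s by blast
  have "u \<union> E \<notin> C k" for k
  proof -
    have "(u \<union> E) \<inter> {..p (Suc k)} = (u \<union> s (Suc k)) \<inter> {..p (Suc k)}"
      using E[of "Suc k"] s[of "Suc k"] by blast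
    moreover have "u \<union> E \<subseteq> pos_ints" using u ED D by blast
    ultimately show ?thesis using Q[of k] unfolding Q_def s_def p_def by blast
  qed
  with cover[OF ED] show False by blast
qed

text \<open>A violation \<open>B\<close> of the universal condition is detected on a finite initial segment, hence it
persists, in truncated form, for all sets that agree with \<open>A\<close> on that segment.\<close>

lemma closedin_all_extensions_in:
  assumes C: "closedin cantor_powerset C" and u: "u \<subseteq> pos_ints" and s: "s \<subseteq> {..p}"
  shows "closedin cantor_powerset
    {A. A \<subseteq> pos_ints \<and> s \<subseteq> A \<and> (\<forall>B\<subseteq>A \<inter> W - {..p}. u \<union> s \<union> B \<in> C)}"
    (is "closedin _ ?E")
  unfolding closedin_cantor_powerset
proof (intro conjI allI impI)
  fix A assume A: "A \<subseteq> pos_ints" "A \<notin> ?E"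
  show "\<exists>q. \<forall>D\<subseteq>pos_ints. D \<inter> {..q} = A \<inter> {..q} \<longrightarrow> D \<notin> ?E"
  proof (cases "s \<subseteq> A")
    case False
    then have "D \<notin> ?E" if "D \<inter> {..p} = A \<inter> {..p}" for D
      using that s by blast
    then show ?thesis by blast
  next
    case True
    with A obtain B where B: "B \<subseteq> A \<inter> W - {..p}" "u \<union> s \<union> B \<notin> C" by blast
    have "u \<union> s \<union> B \<subseteq> pos_ints" using u True A B by blast
    with C B(2) obtain q where
      q: "\<And>E. E \<subseteq> pos_ints \<Longrightarrow> E \<inter> {..q} = (u \<union> s \<union> B) \<inter> {..q} \<Longrightarrow> E \<notin> C"
      unfolding closedin_cantor_powerset by blast
    have "D \<notin> ?E" if D: "D \<subseteq> pos_ints" "D \<inter> {..q} = A \<inter> {..q}" for D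
    proof
      assume DE: "D \<in> ?E"
      have "B \<inter> {..q} \<subseteq> D \<inter> W - {..p}" using B(1) D(2) by blast
      with DE have "u \<union> s \<union> (B \<inter> {..q}) \<in> C" by blast
      moreover have "u \<union> s \<union> (B \<inter> {..q}) \<subseteq> pos_ints" using u True A B by blast
      ultimately show False using q[of "u \<union> s \<union> (B \<inter> {..q})"] by blast
    qed
    then show ?thesis by blast
  qed
qed blast

section \<open>Ideals of class \<open>F\<^sub>\<sigma>\<^sub>\<delta>\<close> are \<open>F\<^sub>\<sigma>\<close>-separated\<close>

lemma ideal_Un: "ideal_on_pos_ints \<I> \<Longrightarrow> A \<in> \<I> \<Longrightarrow> B \<in> \<I> \<Longrightarrow> A \<union> B \<in> \<I>"
  unfolding ideal_on_pos_ints_def by blast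

lemma ideal_subset: "ideal_on_pos_ints \<I> \<Longrightarrow> A \<in> \<I> \<Longrightarrow> B \<subseteq> A \<Longrightarrow> B \<in> \<I>"
  unfolding ideal_on_pos_ints_def by blast

lemma ideal_finite: "ideal_on_pos_ints \<I> \<Longrightarrow> finite A \<Longrightarrow> A \<subseteq> pos_ints \<Longrightarrow> A \<in> \<I>"
  unfolding ideal_on_pos_ints_def by blast

lemma ideal_imp_subset_pos_ints: "ideal_on_pos_ints \<I> \<Longrightarrow> A \<in> \<I> \<Longrightarrow> A \<subseteq> pos_ints"
  unfolding ideal_on_pos_ints_def by (elim conjE) (rule PowD, erule (1) subsetD)

lemma pos_ints_notin_ideal: "ideal_on_pos_ints \<I> \<Longrightarrow> pos_ints \<notin> \<I>"
  unfolding ideal_on_pos_ints_def by (elim conjE)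

lemma dual_filter_Int_Diff_finite:
  assumes "ideal_on_pos_ints \<I>" and A: "A \<in> dual_filter \<I>" and B: "B \<in> dual_filter \<I>"
  shows "A \<inter> B - {..p} \<in> dual_filter \<I>"
proof -
  have "pos_ints - (A \<inter> B - {..p}) = (pos_ints - A) \<union> (pos_ints - B) \<union> (pos_ints \<inter> {..p})"
    by blast
  moreover have "pos_ints \<inter> {..p} \<in> \<I>" using ideal_finite[OF assms(1)] by simp
  moreover have "pos_ints - A \<in> \<I>" "pos_ints - B \<in> \<I>" "A \<subseteq> pos_ints"
    using A B unfolding dual_filter_def by simp_all
  ultimately have "pos_ints - (A \<inter> B - {..p}) \<in> \<I>"
    using ideal_Un[OF assms(1)] by metis
  moreover have "A \<inter> B - {..p} \<subseteq> pos_ints" using \<open>A \<subseteq> pos_ints\<close> by blast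
  ultimately show ?thesis unfolding dual_filter_def by simp
qed

text \<open>One step of the construction of a set in \<open>F\<close> when no separation exists. A set under construction
is decided to be \<open>u\<close> outside the large set \<open>W\<close>; by deciding it on a further part of \<open>W\<close> one can
force it into \<open>F\<close>, while a set \<open>W'\<close> that is still large stays undecided.

For \<open>A \<in> \<I>\<close>, all sets \<open>u \<union> B\<close> with \<open>B \<subseteq> A \<inter> W\<close> belong to \<open>\<I> \<subseteq> F\<close>, so that the Baire
argument yields a finite \<open>s\<close> such that \<open>u \<union> s\<close> followed by any subset of the rest of \<open>A \<inter> W\<close>
lies in a single closed piece of \<open>F\<close>. The sets \<open>A\<close> with this property form an \<open>F\<^sub>\<sigma>\<close>-set. It
contains \<open>\<I>\<close>; as it does not separate \<open>\<I>\<close> from the dual filter, the property also holds for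
some \<open>A\<close> in the dual filter.\<close>

lemma unseparated_capture:
  assumes ideal: "ideal_on_pos_ints \<I>" and unsep: "\<not> fsigma_separated \<I>"
    and F: "fsigma_in cantor_powerset F" "\<I> \<subseteq> F"
    and W: "W \<in> dual_filter \<I>" and u: "u \<subseteq> pos_ints - W"
  shows "\<exists>W' u'. W' \<in> dual_filter \<I> \<and> W' \<subseteq> W \<and> u' \<subseteq> pos_ints - W' \<and>
     u' \<inter> (pos_ints - W) = u \<and> (\<forall>B\<subseteq>W'. u' \<union> B \<in> F)"
proof -
  obtain C :: "nat \<Rightarrow> nat set set" where
    C: "\<And>k. closedin cantor_powerset (C k)" and CF: "(\<Union>k. C k) = F"
    using F(1) unfolding fsigma_in_ascending by blast
  have Wpos: "W \<subseteq> pos_ints" and WI: "pos_ints - W \<in> \<I>"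
    using W unfolding dual_filter_def by simp_all
  have uI: "u \<in> \<I>" by (rule ideal_subset[OF ideal WI u])
  define E where "E k p s =
      {A. A \<subseteq> pos_ints \<and> s \<subseteq> A \<and> (\<forall>B\<subseteq>A \<inter> W - {..p}. u \<union> s \<union> B \<in> C k)}" for k p s
  define J where "J = {(k::nat, p::nat, s). finite s \<and> s \<subseteq> W \<inter> {..p}}"
  have "J \<subseteq> UNIV \<times> UNIV \<times> Collect finite" unfolding J_def by blast
  then have "countable J"
    by (rule countable_subset) (intro countable_SIGMA countableI_type countable_Collect_finite)
  then have "fsigma_in cantor_powerset (\<Union>((\<lambda>(k, p, s). E k p s) ` J))"
  proof (intro fsigma_in_Union closed_imp_fsigma_in countable_image)
    fix S assume "S \<in> (\<lambda>(k, p, s). E k p s) ` J"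
    then obtain k p s where S: "S = E k p s" and s: "s \<subseteq> {..p}" unfolding J_def by auto
    show "closedin cantor_powerset S"
      unfolding S E_def using closedin_all_extensions_in[OF C _ s] u by blast
  qed
  moreover have "\<I> \<subseteq> \<Union>((\<lambda>(k, p, s). E k p s) ` J)"
  proof
    fix A assume A: "A \<in> \<I>"
    then have Apos: "A \<subseteq> pos_ints" using ideal_imp_subset_pos_ints[OF ideal] by blast
    have "u \<union> B \<in> (\<Union>k. C k)" if "B \<subseteq> A \<inter> W" for B
    proof -
      have "B \<in> \<I>" by (rule ideal_subset[OF ideal A]) (use that in blast)
      then show ?thesis using ideal_Un[OF ideal uI] F(2) unfolding CF by blast
    qed
    note cover = this
    have "\<exists>k p s. s \<subseteq> A \<inter> W \<inter> {..p} \<and> (\<forall>B\<subseteq>A \<inter> W - {..p}. u \<union> s \<union> B \<in> C k)"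
    proof (rule cylinder_in_closed_cover[OF C])
      show "A \<inter> W \<subseteq> pos_ints" "u \<subseteq> pos_ints" using Apos u by blast+
    qed (rule cover)
    then obtain k p s where s: "s \<subseteq> A \<inter> W \<inter> {..p}"
      and ext: "\<forall>B\<subseteq>A \<inter> W - {..p}. u \<union> s \<union> B \<in> C k"
      by (elim exE conjE)
    have "A \<in> E k p s" using Apos s ext unfolding E_def by simp
    moreover have "(k, p, s) \<in> J"
      using s finite_subset[OF s] unfolding J_def by auto
    ultimately show "A \<in> \<Union>((\<lambda>(k, p, s). E k p s) ` J)" by force
  qed
  ultimately have "\<Union>((\<lambda>(k, p, s). E k p s) ` J) \<inter> dual_filter \<I> \<noteq> {}"
    using unsep unfolding fsigma_separated_def by metis
  then obtain A j where A: "A \<in> dual_filter \<I>" and j: "j \<in> J" "A \<in> (\<lambda>(k, p, s). E k p s) j"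
    by blast
  obtain k p s where "j = (k, p, s)" by (rule prod_cases3)
  with j have s: "s \<subseteq> W \<inter> {..p}" and AE: "A \<in> E k p s" unfolding J_def by simp_all
  let ?W' = "A \<inter> W - {..p}" and ?u' = "u \<union> s"
  show ?thesis
  proof (intro exI conjI allI impI)
    show "?W' \<in> dual_filter \<I>" by (rule dual_filter_Int_Diff_finite[OF ideal A W])
    show "?W' \<subseteq> W" by blast
    show "?u' \<subseteq> pos_ints - ?W'" "?u' \<inter> (pos_ints - W) = u" using u s Wpos by auto
    fix B assume "B \<subseteq> ?W'"
    then have "?u' \<union> B \<in> C k" using AE unfolding E_def by simp
    then show "?u' \<union> B \<in> F" using CF by blast
  qed
qed

text \<open>Write \<open>\<I>\<close> as the intersection of \<open>F\<^sub>\<sigma>\<close>-sets \<open>F n\<close>. Without a separation, the previous lemma can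
be applied alternately to a set \<open>A\<close> and to its complement: at stage \<open>n\<close> both are forced into \<open>F n\<close>,
and the part of the positive integers that is still undecided always belongs to the dual filter.
In the limit \<open>A\<close> and its complement both belong to \<open>\<I>\<close>, which is absurd.\<close>

theorem fsigma_delta_ideal_separated:
  assumes ideal: "ideal_on_pos_ints \<I>" and Fsd: "fsigma_delta_in cantor_powerset \<I>"
  shows "fsigma_separated \<I>"
proof (rule ccontr)
  assume unsep: "\<not> fsigma_separated \<I>"
  obtain \<U> where \<U>: "countable \<U>" "\<U> \<subseteq> Collect (fsigma_in cantor_powerset)"
    and I\<U>: "\<I> = Pow pos_ints \<inter> \<Inter>\<U>"
    using Fsd unfolding fsigma_delta_in_def relative_to_def intersection_of_def
      topspace_cantor_powerset by blast
  define F where "F = from_nat_into (insert (Pow pos_ints) \<U>)"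
  have ran: "range F = insert (Pow pos_ints) \<U>"
    unfolding F_def using \<U>(1) by (intro range_from_nat_into) auto
  have F: "fsigma_in cantor_powerset (F n)" for n
  proof -
    have "F n \<in> insert (Pow pos_ints) \<U>" using rangeI[of F n] unfolding ran .
    moreover have "fsigma_in cantor_powerset (Pow pos_ints)"
      using fsigma_in_topspace[of cantor_powerset] unfolding topspace_cantor_powerset .
    ultimately show ?thesis using \<U>(2) by (metis insertE mem_Collect_eq subsetD)
  qed
  have I: "\<I> = (\<Inter>n. F n)" unfolding ran I\<U> by simp
  \<comment> \<open>A state \<open>(W, u)\<close> consists of the undecided part \<open>W\<close> and of the part \<open>u\<close> of \<open>A\<close> decided so far.\<close>
  define P where "P z \<longleftrightarrow> fst z \<in> dual_filter \<I> \<and> snd z \<subseteq> pos_ints - fst z"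
    for z :: "nat set \<times> nat set"
  define Q where "Q n z z' \<longleftrightarrow> fst z' \<subseteq> fst z \<and> snd z' \<inter> (pos_ints - fst z) = snd z \<and>
      (\<forall>B\<subseteq>fst z'. snd z' \<union> B \<in> F n \<and> pos_ints - (snd z' \<union> B) \<in> F n)"
    for n and z z' :: "nat set \<times> nat set"
  have "\<exists>z. \<forall>n. P (z n) \<and> Q n (z n) (z (Suc n))"
  proof (rule dependent_nat_choice)
    have "pos_ints \<in> dual_filter \<I>"
      using ideal_finite[OF ideal] unfolding dual_filter_def by simp
    then show "\<exists>z. P z" unfolding P_def by (intro exI[of _ "(pos_ints, {})"]) simp
  next
    fix z n assume "P z"
    then have z: "fst z \<in> dual_filter \<I>" "snd z \<subseteq> pos_ints - fst z" unfolding P_def by auto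
    have IF: "\<I> \<subseteq> F n" using I by blast
    \<comment> \<open>First force \<open>A\<close> into \<open>F n\<close>, then force its complement there, starting from what
  the first choice leaves outside \<open>A\<close>.\<close>
    obtain V u where V: "V \<in> dual_filter \<I>" "V \<subseteq> fst z" and u: "u \<subseteq> pos_ints - V"
      "u \<inter> (pos_ints - fst z) = snd z" and uF: "\<And>B. B \<subseteq> V \<Longrightarrow> u \<union> B \<in> F n"
      using unseparated_capture[OF ideal unsep F IF z] by metis
    obtain W v where W: "W \<in> dual_filter \<I>" "W \<subseteq> V" and v: "v \<subseteq> pos_ints - W"
      "v \<inter> (pos_ints - V) = pos_ints - V - u" and vF: "\<And>B. B \<subseteq> W \<Longrightarrow> v \<union> B \<in> F n"
      using unseparated_capture[OF ideal unsep F IF V(1), of "pos_ints - V - u"] by (metis Diff_subset)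
    have Vpos: "V \<subseteq> pos_ints"
      using V(1) unfolding dual_filter_def by auto
    define t where "t = pos_ints - W - v"
    have tV: "t \<inter> (pos_ints - V) = u"
      using v u W(2) unfolding t_def by blast
    have "t \<inter> (pos_ints - fst z) = t \<inter> (pos_ints - V) \<inter> (pos_ints - fst z)"
      using V(2) by blast
    also have "\<dots> = snd z" unfolding tV by (rule u(2))
    finally have tz: "t \<inter> (pos_ints - fst z) = snd z" .
    have "t \<union> B \<in> F n \<and> pos_ints - (t \<union> B) \<in> F n" if B: "B \<subseteq> W" for B
    proof
      have "u \<union> ((t \<union> B) \<inter> V) = t \<union> B"
        using tV u(1) B W(2) unfolding t_def by blast
      then show "t \<union> B \<in> F n" using uF[of "(t \<union> B) \<inter> V"] by simp
      have "pos_ints - (t \<union> B) = v \<union> (W - B)"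
        using v(1) B W(2) Vpos unfolding t_def by blast
      then show "pos_ints - (t \<union> B) \<in> F n" using vF[of "W - B"] by simp
    qed
    moreover have "t \<subseteq> pos_ints - W" unfolding t_def by blast
    ultimately show "\<exists>z'. P z' \<and> Q n z z'"
      unfolding P_def Q_def using W V(2) tz by (intro exI[of _ "(W, t)"]) auto
  qed
  then obtain z where P: "\<And>n. P (z n)" and Q: "\<And>n. Q n (z n) (z (Suc n))" by blast
  define A where "A = (\<Union>n. snd (z n))"
  have A: "A \<inter> (pos_ints - fst (z n)) = snd (z n)" for n
    unfolding A_def
  proof (rule Union_coherent_Int)
    show "pos_ints - fst (z n) \<subseteq> pos_ints - fst (z (Suc n))" for n
      using Q[of n] unfolding Q_def by blast
    show "snd (z n) \<subseteq> pos_ints - fst (z n)" for n using P[of n] unfolding P_def by blast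
    show "snd (z (Suc n)) \<inter> (pos_ints - fst (z n)) = snd (z n)" for n
      using Q[of n] unfolding Q_def by blast
  qed
  have Apos: "A \<subseteq> pos_ints" using P unfolding A_def P_def by blast
  have "A \<in> F n \<and> pos_ints - A \<in> F n" for n
  proof -
    have "snd (z (Suc n)) \<union> (A \<inter> fst (z (Suc n))) = A"
      using A[of "Suc n"] Apos by blast
    moreover have "A \<inter> fst (z (Suc n)) \<subseteq> fst (z (Suc n))" by blast
    ultimately show ?thesis using Q[of n] unfolding Q_def by metis
  qed
  then have "A \<in> (\<Inter>n. F n)" "pos_ints - A \<in> (\<Inter>n. F n)" by blast+
  then have "A \<union> (pos_ints - A) \<in> \<I>" unfolding I[symmetric] by (rule ideal_Un[OF ideal])
  moreover have "A \<union> (pos_ints - A) = pos_ints" using Apos by (rule Diff_partition)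
  ultimately show False using pos_ints_notin_ideal[OF ideal] by simp
qed

section \<open>Dyadic expansions and their prefixes\<close>

definition dyadic_support :: "real \<Rightarrow> nat set" where
  "dyadic_support \<omega> = {i \<in> pos_ints. dyadic_digit \<omega> i = 1}"

lemma infinite_dyadic_support: "\<omega> \<in> {0<..1} \<Longrightarrow> infinite (dyadic_support \<omega>)"
  using nonterminating_dyadic_digit[of \<omega>]
  unfolding nonterminating_dyadic_def dyadic_support_def by simp

lemma dyadic_digit_eq_of_bool:
  assumes "\<omega> \<in> {0<..1}"
  shows "dyadic_digit \<omega> i = of_bool (i \<in> dyadic_support \<omega>)"
proof -
  note nd = nonterminating_dyadic_digit[OF assms, unfolded nonterminating_dyadic_def]
  show ?thesis
  proof (cases "i = 0")
    case True
    then show ?thesis using nd by (simp add: dyadic_support_def)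
  next
    case False
    then have "i \<in> pos_ints" by simp
    with nd have "dyadic_digit \<omega> i \<in> {0, 1}" by (elim conjE) (drule (1) bspec)
    with \<open>i \<in> pos_ints\<close> show ?thesis unfolding dyadic_support_def by auto
  qed
qed

lemma dyadic_support_sums:
  assumes "\<omega> \<in> {0<..1}"
  shows "(\<lambda>i. of_bool (Suc i \<in> dyadic_support \<omega>) * (1/2) ^ Suc i) sums \<omega>"
  using nonterminating_dyadic_digit[OF assms]
  unfolding nonterminating_dyadic_def dyadic_digit_eq_of_bool[OF assms]
  by (simp add: power_one_over)

lemma dyadic_tail_bounds:
  fixes r :: nat
  assumes "\<omega> \<in> {0<..1}"
  defines "S \<equiv> (\<Sum>i<r. of_bool (Suc i \<in> dyadic_support \<omega>) * (1/2::real) ^ Suc i)"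
  shows "S \<le> \<omega>" "\<omega> \<le> S + (1/2) ^ r"
proof -
  define g where "g i = of_bool (Suc i \<in> dyadic_support \<omega>) * (1/2::real) ^ Suc i" for i
  have g: "g sums \<omega>" unfolding g_def by (rule dyadic_support_sums[OF assms(1)])
  have tail: "(\<lambda>i. g (i + r)) sums (\<omega> - S)"
    unfolding S_def g_def[symmetric] sums_iff_shift using g by simp
  have geometric: "(\<lambda>i. (1/2::real) ^ r * (1/2) ^ Suc i) sums ((1/2) ^ r * 1)"
    by (intro sums_mult power_half_series)
  have "g (i + r) \<le> (1/2::real) ^ r * (1/2) ^ Suc i" for i
    by (simp add: g_def power_add)
  then have "\<omega> - S \<le> (1/2) ^ r * 1" by (rule sums_le[OF _ tail geometric])
  then show "\<omega> \<le> S + (1/2) ^ r" by simp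
  have "0 \<le> g (i + r)" for i unfolding g_def by simp
  then have "0 \<le> \<omega> - S" by (rule sums_le[OF _ sums_zero tail])
  then show "S \<le> \<omega>" by simp
qed

lemma dyadic_support_prefix_imp_close:
  assumes "\<omega> \<in> {0<..1}" "\<omega>' \<in> {0<..1}"
    and "dyadic_support \<omega> \<inter> {..r} = dyadic_support \<omega>' \<inter> {..r}"
  shows "\<bar>\<omega> - \<omega>'\<bar> \<le> (1/2) ^ r"
proof -
  have "i \<in> dyadic_support \<omega> \<longleftrightarrow> i \<in> dyadic_support \<omega>'" if "i \<le> r" for i
    using assms(3) that by blast
  then have "(\<Sum>i<r. of_bool (Suc i \<in> dyadic_support \<omega>) * (1/2::real) ^ Suc i) =
      (\<Sum>i<r. of_bool (Suc i \<in> dyadic_support \<omega>') * (1/2::real) ^ Suc i)"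
    by (intro sum.cong) auto
  then show ?thesis
    using dyadic_tail_bounds[OF assms(1), of r] dyadic_tail_bounds[OF assms(2), of r] by linarith
qed

text \<open>The left endpoint \<open>a\<close> is the value of the prescribed prefix. Rescaling the interval to \<open>(0, 1]\<close>
supplies the remaining digits, and uniqueness of the nonterminating expansion shows that
they are the digits of \<open>\<omega>\<close>.\<close>

lemma dyadic_cylinder_contains_interval:
  obtains a where "0 \<le> a" "a + (1/2) ^ r \<le> 1"
    "\<And>\<omega>. \<omega> \<in> {a<..a + (1/2) ^ r} \<Longrightarrow> dyadic_support \<omega> \<inter> {..r} = D \<inter> {1..r}"
proof
  define a where "a = (\<Sum>i<r. of_bool (Suc i \<in> D) * (1/2::real) ^ Suc i)"
  show a0: "0 \<le> a" unfolding a_def by (intro sum_nonneg) simp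
  have "a \<le> (\<Sum>i<r. (1/2) ^ Suc i)" unfolding a_def by (intro sum_mono) simp
  also have "\<dots> = 1 - (1/2) ^ r" by (induction r) (simp_all add: field_simps)
  finally show a1: "a + (1/2) ^ r \<le> 1" by simp
  fix \<omega> assume \<omega>: "\<omega> \<in> {a<..a + (1/2) ^ r}"
  define \<theta> where "\<theta> = (\<omega> - a) * 2 ^ r"
  have \<theta>: "\<theta> \<in> {0<..1}" using \<omega> unfolding \<theta>_def by (auto simp: field_simps)
  have \<theta>_eq: "\<theta> * (1/2) ^ r = \<omega> - a" unfolding \<theta>_def by (simp add: power_one_over)
  \<comment> \<open>The prescribed prefix followed by the digits of the rescaled point.\<close>
  define d where "d i = (if i = 0 then 0 else if i \<le> r then of_bool (i \<in> D)
      else dyadic_digit \<theta> (i - r))" for i :: nat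
  define g where "g i = real (d (Suc i)) / 2 ^ Suc i" for i
  have "nonterminating_dyadic \<omega> d"
    unfolding nonterminating_dyadic_def
  proof (intro conjI ballI)
    show "d 0 = 0" by (simp add: d_def)
    show "d i \<in> {0, 1}" for i
      using dyadic_digit_eq_of_bool[OF \<theta>, of "i - r"] by (simp add: d_def)
    have "(+) r ` dyadic_support \<theta> \<subseteq> {i \<in> pos_ints. d i = 1}"
      by (auto simp: d_def dyadic_support_def)
    moreover have "infinite ((+) r ` dyadic_support \<theta>)"
      using infinite_dyadic_support[OF \<theta>] by (simp add: finite_image_iff)
    ultimately show "infinite {i \<in> pos_ints. d i = 1}" using finite_subset by blast
    have "(\<lambda>i. of_bool (Suc i \<in> dyadic_support \<theta>) * (1/2) ^ Suc i * (1/2) ^ r) sums (\<theta> * (1/2) ^ r)"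
      by (intro sums_mult2 dyadic_support_sums \<theta>)
    moreover have "of_bool (Suc i \<in> dyadic_support \<theta>) * (1/2) ^ Suc i * (1/2) ^ r = g (i + r)" for i
      using dyadic_digit_eq_of_bool[OF \<theta>, of "Suc i"]
      by (simp add: g_def d_def power_add power_one_over)
    ultimately have "(\<lambda>i. g (i + r)) sums (\<omega> - a)" unfolding \<theta>_eq by simp
    moreover have "a = (\<Sum>i<r. g i)"
      unfolding a_def g_def d_def by (intro sum.cong) (auto simp: power_one_over)
    ultimately have "g sums \<omega>" unfolding sums_iff_shift by simp
    then show "(\<lambda>i. real (d (Suc i)) / 2 ^ Suc i) sums \<omega>" unfolding g_def .
  qed
  moreover have "\<omega> \<in> {0<..1}" using \<omega> a0 a1 by auto
  ultimately have "dyadic_digit \<omega> = d"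
    using nonterminating_dyadic_digit nonterminating_dyadic_unique by blast
  then show "dyadic_support \<omega> \<inter> {..r} = D \<inter> {1..r}"
    unfolding dyadic_support_def d_def by auto
qed

text \<open>This reduces nowhere density to a combinatorial condition on digits: every prefix can be prolonged
to one that excludes the set. Prefixes of length \<open>r\<close> determine a point up to \<open>(1/2) ^ r\<close>, so a small
neighborhood is reached by prolonging a long prefix of its center, and the prolonged prefix is
shared by all points of an open interval.\<close>

lemma nowhere_dense_if_prefix_avoids:
  assumes M: "M \<subseteq> {0<..1}"
    and avoid: "\<And>E r. E \<subseteq> pos_ints \<Longrightarrow> \<exists>D r'. D \<subseteq> pos_ints \<and> r \<le> r' \<and> D \<inter> {..r} = E \<inter> {..r} \<and>
      (\<forall>\<omega>\<in>M. dyadic_support \<omega> \<inter> {..r'} \<noteq> D \<inter> {..r'})"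
  shows "nowhere_dense_in (top_of_set {0<..1}) M"
proof -
  let ?X = "top_of_set {0<..1::real}"
  let ?U = "?X interior_of (?X closure_of M)"
  have False if w0: "\<omega>0 \<in> ?U" for \<omega>0
  proof -
    obtain T where T: "open T" "?U = {0<..1} \<inter> T"
      using openin_interior_of[of ?X "?X closure_of M"] unfolding openin_open by blast
    then have \<omega>0: "\<omega>0 \<in> {0<..1}" "\<omega>0 \<in> T" using w0 by auto
    obtain e where e: "0 < e" "ball \<omega>0 e \<subseteq> T"
      using T(1) \<omega>0(2) by (rule openE)
    obtain r where r: "(1/2) ^ r < e" using real_arch_pow_inv[OF e(1), of "1/2"] by auto
    have "dyadic_support \<omega>0 \<subseteq> pos_ints" unfolding dyadic_support_def by blast
    from avoid[OF this, of r] obtain D r' where D: "D \<subseteq> pos_ints" "r \<le> r'"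
      "D \<inter> {..r} = dyadic_support \<omega>0 \<inter> {..r}"
      "\<forall>\<omega>\<in>M. dyadic_support \<omega> \<inter> {..r'} \<noteq> D \<inter> {..r'}" by (elim exE conjE)
    obtain a where a: "0 \<le> a" "a + (1/2) ^ r' \<le> 1"
      "\<And>\<omega>. \<omega> \<in> {a<..a + (1/2) ^ r'} \<Longrightarrow> dyadic_support \<omega> \<inter> {..r'} = D \<inter> {1..r'}"
      using dyadic_cylinder_contains_interval[of r' D] by metis
    have Dr': "D \<inter> {1..r'} = D \<inter> {..r'}" using D(1) by auto
    define V where "V = {a<..<a + (1/2) ^ r'}"
    have V01: "V \<subseteq> {0<..1}" unfolding V_def using a(1,2) by auto
    have Vsupp: "dyadic_support \<omega> \<inter> {..r'} = D \<inter> {..r'}" if "\<omega> \<in> V" for \<omega>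
      using a(3)[of \<omega>] that unfolding V_def Dr' by simp
    have "V \<subseteq> ?U"
    proof
      fix \<omega> assume \<omega>: "\<omega> \<in> V"
      have "dyadic_support \<omega> \<inter> {..r} = dyadic_support \<omega> \<inter> {..r'} \<inter> {..r}" using D(2) by auto
      also have "\<dots> = D \<inter> {..r}" unfolding Vsupp[OF \<omega>] using D(2) by auto
      finally have "\<bar>\<omega> - \<omega>0\<bar> \<le> (1/2) ^ r"
        using V01 \<omega> \<omega>0(1) unfolding D(3) by (intro dyadic_support_prefix_imp_close) auto
      then have "\<omega> \<in> ball \<omega>0 e" using r by (simp add: dist_real_def)
      with e(2) have "\<omega> \<in> T" by (rule subsetD)
      with V01 \<omega> show "\<omega> \<in> ?U" unfolding T(2) by (intro IntI) (rule subsetD)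
    qed
    then have Vcl: "V \<subseteq> ?X closure_of M" by (rule subset_trans[OF _ interior_of_subset])
    have "a + (1/2) ^ r' / 2 \<in> V" unfolding V_def by simp
    moreover have "openin ?X V"
      using V01 unfolding openin_open V_def by (intro exI[of _ "{a<..<a + (1/2) ^ r'}"]) auto
    ultimately have "\<exists>\<omega>. \<omega> \<in> M \<and> \<omega> \<in> V"
      using subsetD[OF Vcl] unfolding in_closure_of by metis
    then obtain \<omega> where \<omega>: "\<omega> \<in> M" "\<omega> \<in> V" by (elim exE conjE)
    show False using bspec[OF D(4) \<omega>(1)] Vsupp[OF \<omega>(2)] by (rule notE)
  qed
  then show ?thesis using M unfolding nowhere_dense_in_def by auto
qed

section \<open>Positions of a subsequence that fall into a given set\<close>

lemma enumerate_eq_if_prefix_eq: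
  fixes A B :: "nat set"
  assumes A: "infinite A" and B: "infinite B" and eq: "A \<inter> {..r} = B \<inter> {..r}"
    and "enumerate B m \<le> r"
  shows "enumerate A m = enumerate B m"
proof -
  have iff: "i \<in> A \<longleftrightarrow> i \<in> B" if "i \<le> r" for i using eq that by blast
  show ?thesis
    using assms(4)
  proof (induction m)
    case 0
    have "enumerate B 0 \<in> A" using iff 0 enumerate_in_set[OF B] by blast
    moreover have "enumerate B 0 \<le> y" if y: "y \<in> A" for y
    proof (rule ccontr)
      assume "\<not> ?thesis"
      then have lt: "y < enumerate B 0" by simp
      then have "y \<in> B" using iff 0 y by auto
      then have "enumerate B 0 \<le> y" unfolding enumerate_0 by (rule Least_le)
      with lt show False by simp
    qed
    ultimately show ?case unfolding enumerate_0[of A] by (intro Least_equality)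
  next
    case (Suc m)
    have lt: "enumerate B m < enumerate B (Suc m)" by (rule enumerate_step[OF B])
    with Suc have IH: "enumerate A m = enumerate B m" by simp
    have "enumerate B (Suc m) \<in> A" using iff Suc.prems enumerate_in_set[OF B] by blast
    moreover have "enumerate B (Suc m) \<le> y" if y: "y \<in> A" "enumerate B m < y" for y
    proof (rule ccontr)
      assume "\<not> ?thesis"
      then have lt: "y < enumerate B (Suc m)" by simp
      then have "y \<in> B" using iff Suc.prems y by auto
      then have "enumerate B (Suc m) \<le> y"
        unfolding enumerate_Suc''[OF B] using y(2) by (intro Least_le) simp
      with lt show False by simp
    qed
    ultimately show ?case
      unfolding enumerate_Suc''[OF A] IH using lt by (intro Least_equality) auto
  qed
qed

text \<open>If \<open>D\<close> is the set of positions kept by a subsequence and \<open>S\<close> is the set of \<open>n\<close> with \<open>x n \<in> U\<close>, this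
is the set of \<open>k \<ge> 1\<close> whose \<open>k\<close>-th kept term lies in \<open>U\<close>. The shift compensates for
\<^const>\<open>enumerate\<close> counting from \<open>0\<close>.\<close>

definition indices_in :: "nat set \<Rightarrow> nat set \<Rightarrow> nat set" where
  "indices_in S D = {k \<in> pos_ints. enumerate D (k - 1) \<in> S}"

lemma indices_in_prefix_eq:
  assumes "infinite A" "infinite B" "A \<inter> {..r} = B \<inter> {..r}" "enumerate B q \<le> r"
  shows "indices_in S A \<inter> {..q} = indices_in S B \<inter> {..q}"
proof -
  have "enumerate A (k - 1) = enumerate B (k - 1)" if "k \<le> q" for k
  proof (rule enumerate_eq_if_prefix_eq[OF assms(1-3)])
    have "enumerate B (k - 1) \<le> enumerate B q" using that assms(2) by simp
    then show "enumerate B (k - 1) \<le> r" using assms(4) by simp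
  qed
  then show ?thesis unfolding indices_in_def by auto
qed

lemma finite_indices_in:
  assumes "infinite D" "finite S"
  shows "finite (indices_in S D)"
proof -
  obtain b where b: "S \<subseteq> {..b}" using assms(2) finite_nat_iff_bounded_le by blast
  have "indices_in S D \<subseteq> {..Suc b}"
  proof
    fix k assume "k \<in> indices_in S D"
    then have "enumerate D (k - 1) \<in> S" unfolding indices_in_def by simp
    then have "enumerate D (k - 1) \<le> b" using b by blast
    moreover have "k - 1 \<le> enumerate D (k - 1)" by (rule le_enumerate[OF assms(1)])
    ultimately show "k \<in> {..Suc b}" by simp
  qed
  then show ?thesis by (rule finite_subset) simp
qed

lemma dyadic_subseq_indices:
  assumes "\<omega> \<in> {0<..1}"
  shows "{k \<in> pos_ints. dyadic_subseq x \<omega> k \<in> U} =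
    indices_in {n \<in> pos_ints. x n \<in> U} (dyadic_support \<omega>)"
proof -
  have "enumerate (dyadic_support \<omega>) m \<in> pos_ints" for m
    using enumerate_in_set[OF infinite_dyadic_support[OF assms], of m]
    unfolding dyadic_support_def by simp
  then show ?thesis
    unfolding indices_in_def dyadic_subseq_def dyadic_support_def[symmetric] by auto
qed

text \<open>After any prefix of digits, keep from then on only elements of \<open>S\<close>. Then all but finitely many kept
terms have their index in \<open>S\<close>, so the set of their positions is cofinite and belongs to the dual
filter. A closed set \<open>C\<close> that misses the dual filter excludes it already because of a finite
initial segment, which in turn depends only on finitely many digits.\<close>

lemma nowhere_dense_indices_in_closed:
  assumes ideal: "ideal_on_pos_ints \<I>"
    and C: "closedin cantor_powerset C" "C \<inter> dual_filter \<I> = {}"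
    and S: "infinite S" "S \<subseteq> pos_ints"
  shows "nowhere_dense_in (top_of_set {0<..1})
    {\<omega> \<in> {0<..1}. indices_in S (dyadic_support \<omega>) \<in> C}"
proof (rule nowhere_dense_if_prefix_avoids)
  fix E :: "nat set" and r :: nat assume E: "E \<subseteq> pos_ints"
  define D where "D = (E \<inter> {..r}) \<union> (S - {..r})"
  have Dpos: "D \<subseteq> pos_ints" using E S(2) unfolding D_def by blast
  have "infinite (S - {..r})" using S(1) by simp
  then have Dinf: "infinite D" unfolding D_def by simp
  have "pos_ints - indices_in S D \<subseteq> {..Suc r}"
  proof
    fix k assume k: "k \<in> pos_ints - indices_in S D"
    then have "enumerate D (k - 1) \<notin> S" unfolding indices_in_def by simp
    moreover have "enumerate D (k - 1) \<in> D" by (rule enumerate_in_set[OF Dinf])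
    ultimately have "enumerate D (k - 1) \<le> r" unfolding D_def by simp
    moreover have "k - 1 \<le> enumerate D (k - 1)" by (rule le_enumerate[OF Dinf])
    ultimately show "k \<in> {..Suc r}" by simp
  qed
  then have "pos_ints - indices_in S D \<in> \<I>"
    using ideal_finite[OF ideal] finite_subset by blast
  moreover have pos: "indices_in S D \<subseteq> pos_ints" for D unfolding indices_in_def by blast
  ultimately have "indices_in S D \<in> dual_filter \<I>" unfolding dual_filter_def by simp
  then have "indices_in S D \<notin> C" using C(2) by (metis disjoint_iff)
  then have "\<exists>q. \<forall>A\<subseteq>pos_ints. A \<inter> {..q} = indices_in S D \<inter> {..q} \<longrightarrow> A \<notin> C"
    by (rule C(1)[unfolded closedin_cantor_powerset, THEN conjunct2, rule_format, OF pos])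
  then obtain q where
    q: "A \<notin> C" if "A \<subseteq> pos_ints" "A \<inter> {..q} = indices_in S D \<inter> {..q}" for A
    by metis
  define r' where "r' = max r (enumerate D q)"
  have "dyadic_support \<omega> \<inter> {..r'} \<noteq> D \<inter> {..r'}"
    if \<omega>: "\<omega> \<in> {\<omega> \<in> {0<..1}. indices_in S (dyadic_support \<omega>) \<in> C}" for \<omega>
  proof
    assume eq: "dyadic_support \<omega> \<inter> {..r'} = D \<inter> {..r'}"
    have "infinite (dyadic_support \<omega>)" using \<omega> infinite_dyadic_support by blast
    then have "indices_in S (dyadic_support \<omega>) \<inter> {..q} = indices_in S D \<inter> {..q}"
      using eq by (rule indices_in_prefix_eq[OF _ Dinf]) (simp add: r'_def)
    then have "indices_in S (dyadic_support \<omega>) \<notin> C" by (rule q[OF pos])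
    then show False using \<omega> by blast
  qed
  moreover have "D \<inter> {..r} = E \<inter> {..r}" unfolding D_def by blast
  moreover have "r \<le> r'" unfolding r'_def by simp
  ultimately show "\<exists>D r'. D \<subseteq> pos_ints \<and> r \<le> r' \<and> D \<inter> {..r} = E \<inter> {..r} \<and>
      (\<forall>\<omega>\<in>{\<omega> \<in> {0<..1}. indices_in S (dyadic_support \<omega>) \<in> C}.
        dyadic_support \<omega> \<inter> {..r'} \<noteq> D \<inter> {..r'})"
    using Dpos by (intro exI[of _ D] exI[of _ r'] conjI ballI)
qed blast

section \<open>Baire category on the half-open unit interval\<close>

lemma nowhere_dense_in_subset:
  "nowhere_dense_in X S \<Longrightarrow> T \<subseteq> S \<Longrightarrow> nowhere_dense_in X T"
  unfolding nowhere_dense_in_def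
  by (metis closure_of_mono interior_of_mono subset_empty subset_trans)

lemma meager_in_UN:
  assumes "countable J" "\<And>j. j \<in> J \<Longrightarrow> meager_in X (M j)"
  shows "meager_in X (\<Union>j\<in>J. M j)"
  using assms unfolding meager_in_def by (rule countable_union_of_UN)

lemma meager_in_subset:
  assumes "meager_in X S" "T \<subseteq> S"
  shows "meager_in X T"
proof -
  obtain \<U> where \<U>: "countable \<U>" "\<And>N. N \<in> \<U> \<Longrightarrow> nowhere_dense_in X N" "\<Union>\<U> = S"
    using assms(1) unfolding meager_in_def union_of_def by blast
  have "meager_in X (\<Union>N\<in>\<U>. N \<inter> T)"
    using \<U>(1)
  proof (rule meager_in_UN)
    fix N assume "N \<in> \<U>"
    then have "nowhere_dense_in X (N \<inter> T)" using \<U>(2) nowhere_dense_in_subset by blast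
    then show "meager_in X (N \<inter> T)" unfolding meager_in_def by (rule countable_union_of_inc)
  qed
  moreover have "(\<Union>N\<in>\<U>. N \<inter> T) = T" using \<U>(3) assms(2) by blast
  ultimately show ?thesis by simp
qed

text \<open>The interval is open in the compact space \<open>[0, 1]\<close>, hence locally compact, and the Baire category
theorem applies to it.\<close>

lemma unit_interval_not_meager: "\<not> meager_in (top_of_set {0<..1::real}) {0<..1}"
proof
  let ?X = "top_of_set {0<..1::real}"
  assume "meager_in ?X {0<..1}"
  then obtain \<U> where \<U>: "countable \<U>" "\<And>N. N \<in> \<U> \<Longrightarrow> nowhere_dense_in ?X N" "\<Union>\<U> = {0<..1}"
    unfolding meager_in_def union_of_def by blast
  have "locally_compact_space (subtopology (top_of_set {0..1::real}) {0<..1})"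
  proof (rule locally_compact_space_open_subset)
    show "locally_compact_space (top_of_set {0..1::real})"
      by (intro compact_imp_locally_compact_space) (simp add: compact_space_subtopology)
    have "{0<..1} = {0..1} \<inter> {(0::real)<..}" by auto
    then show "openin (top_of_set {0..1}) {0<..1::real}"
      unfolding openin_open by (intro exI[of _ "{0<..}"]) simp
  qed (simp add: regular_space_subtopology regular_space_euclidean)
  moreover have "subtopology (top_of_set {0..1::real}) {0<..1} = ?X"
    by (simp add: subtopology_subtopology Int_absorb1 subset_iff)
  ultimately have lc: "locally_compact_space ?X" by simp
  have "?X interior_of \<Union>((\<lambda>N. ?X closure_of N) ` \<U>) = {}"
  proof (rule Baire_category_alt)
    show "completely_metrizable_space ?X \<or> locally_compact_space ?X \<and> regular_space ?X"
      using lc by (simp add: regular_space_subtopology regular_space_euclidean)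
    show "countable ((\<lambda>N. ?X closure_of N) ` \<U>)" using \<U>(1) by simp
  next
    fix T assume "T \<in> (\<lambda>N. ?X closure_of N) ` \<U>"
    then show "closedin ?X T \<and> ?X interior_of T = {}"
      using \<U>(2) unfolding nowhere_dense_in_def by auto
  qed
  moreover have "\<Union>((\<lambda>N. ?X closure_of N) ` \<U>) = topspace ?X"
  proof
    show "\<Union>((\<lambda>N. ?X closure_of N) ` \<U>) \<subseteq> topspace ?X"
      by (intro UN_least closure_of_subset_topspace)
    show "topspace ?X \<subseteq> \<Union>((\<lambda>N. ?X closure_of N) ` \<U>)"
    proof
      fix \<omega> assume "\<omega> \<in> topspace ?X"
      then have "\<omega> \<in> \<Union>\<U>" unfolding \<U>(3) by simp
      then obtain N where N: "N \<in> \<U>" "\<omega> \<in> N" by (rule UnionE)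
      have "N \<subseteq> topspace ?X" using \<U>(2)[OF N(1)] unfolding nowhere_dense_in_def ..
      then have "\<omega> \<in> ?X closure_of N" using N(2) by (rule subsetD[OF closure_of_subset])
      then show "\<omega> \<in> \<Union>((\<lambda>N. ?X closure_of N) ` \<U>)" using N(1) by blast
    qed
  qed
  ultimately have "?X interior_of topspace ?X = {}" by metis
  then have "{0<..1::real} = {}" unfolding interior_of_topspace by simp
  moreover have "(1::real) \<in> {0<..1}" by simp
  ultimately show False by (metis empty_iff)
qed

text \<open>This is where the separation is used: an \<open>F\<^sub>\<sigma>\<close>-set that separates \<open>\<I>\<close> from its dual filter covers
\<open>\<I>\<close> by countably many closed sets to which the preceding nowhere density result applies.\<close>

lemma meager_indices_in_ideal:
  assumes ideal: "ideal_on_pos_ints \<I>" and sep: "fsigma_separated \<I>"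
    and S: "infinite S" "S \<subseteq> pos_ints"
  shows "meager_in (top_of_set {0<..1})
    {\<omega> \<in> {0<..1}. indices_in S (dyadic_support \<omega>) \<in> \<I>}"
proof -
  obtain A where A: "fsigma_in cantor_powerset A" "\<I> \<subseteq> A" "A \<inter> dual_filter \<I> = {}"
    using sep unfolding fsigma_separated_def by (elim exE conjE)
  obtain C :: "nat \<Rightarrow> nat set set" where
    C: "\<And>k. closedin cantor_powerset (C k)" and CA: "(\<Union>k. C k) = A"
    using A(1) unfolding fsigma_in_ascending by metis
  have "meager_in (top_of_set {0<..1})
      (\<Union>k\<in>UNIV. {\<omega> \<in> {0<..1}. indices_in S (dyadic_support \<omega>) \<in> C k})"
  proof (rule meager_in_UN)
    fix k
    have "C k \<inter> dual_filter \<I> = {}" using CA A(3) by blast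
    then have "nowhere_dense_in (top_of_set {0<..1})
        {\<omega> \<in> {0<..1}. indices_in S (dyadic_support \<omega>) \<in> C k}"
      by (rule nowhere_dense_indices_in_closed[OF ideal C _ S])
    then show "meager_in (top_of_set {0<..1})
        {\<omega> \<in> {0<..1}. indices_in S (dyadic_support \<omega>) \<in> C k}"
      unfolding meager_in_def by (rule countable_union_of_inc)
  qed simp
  moreover have "{\<omega> \<in> {0<..1}. indices_in S (dyadic_support \<omega>) \<in> \<I>} \<subseteq>
      (\<Union>k\<in>UNIV. {\<omega> \<in> {0<..1}. indices_in S (dyadic_support \<omega>) \<in> C k})"
  proof
    fix \<omega> assume "\<omega> \<in> {\<omega> \<in> {0<..1}. indices_in S (dyadic_support \<omega>) \<in> \<I>}"
    then have \<omega>: "\<omega> \<in> {0<..1}" "indices_in S (dyadic_support \<omega>) \<in> \<I>" by simp_all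
    from A(2) \<omega>(2) have "indices_in S (dyadic_support \<omega>) \<in> (\<Union>k. C k)" unfolding CA by (rule subsetD)
    with \<omega>(1) show "\<omega> \<in> (\<Union>k\<in>UNIV. {\<omega> \<in> {0<..1}. indices_in S (dyadic_support \<omega>) \<in> C k})"
      by simp
  qed
  ultimately show ?thesis by (rule meager_in_subset)
qed

section \<open>Cluster points and limit points\<close>

text \<open>In a first countable space the limit points are the cluster points with respect to the ideal of
finite sets. This puts both notions into the same form, so that they can be compared through the
sets of indices attached to a neighborhood.\<close>

lemma ordinary_limit_points_eq:
  assumes X: "first_countable X"
  shows "ordinary_limit_points X x =
    {l \<in> topspace X. \<forall>U. openin X U \<and> l \<in> U \<longrightarrow> infinite {n \<in> pos_ints. x n \<in> U}}"
    (is "_ = ?R")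
proof
  show "ordinary_limit_points X x \<subseteq> ?R"
  proof
    fix l assume "l \<in> ordinary_limit_points X x"
    then obtain r :: "nat \<Rightarrow> nat" where r: "strict_mono r" "range r \<subseteq> pos_ints"
      and lim: "limitin X (x \<circ> r) l sequentially" and l: "l \<in> topspace X"
      unfolding ordinary_limit_points_def by blast
    have "infinite {n \<in> pos_ints. x n \<in> U}" if U: "openin X U" "l \<in> U" for U
    proof -
      obtain N where N: "\<And>n. N \<le> n \<Longrightarrow> x (r n) \<in> U"
        using lim U unfolding limitin_def eventually_sequentially by auto
      then have "r ` {N..} \<subseteq> {n \<in> pos_ints. x n \<in> U}" using r(2) by auto
      moreover have "infinite (r ` {N..})"
        using strict_mono_imp_inj_on[OF r(1)] infinite_Ici
        by (metis finite_imageD inj_on_subset subset_UNIV)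
      ultimately show ?thesis using finite_subset by blast
    qed
    with l show "l \<in> ?R" by blast
  qed
next
  show "?R \<subseteq> ordinary_limit_points X x"
  proof
    fix l assume "l \<in> ?R"
    then have l: "l \<in> topspace X"
      and inf: "\<And>U. openin X U \<Longrightarrow> l \<in> U \<Longrightarrow> infinite {n \<in> pos_ints. x n \<in> U}" by blast+
    obtain \<B> where \<B>: "countable \<B>" "\<forall>V\<in>\<B>. openin X V"
      and base: "\<forall>U. openin X U \<and> l \<in> U \<longrightarrow> (\<exists>V\<in>\<B>. l \<in> V \<and> V \<subseteq> U)"
      using bspec[OF X[unfolded first_countable_def] l] by (elim exE conjE)
    define \<B>' where "\<B>' = {V \<in> \<B>. l \<in> V}"
    have ne: "\<B>' \<noteq> {}" using base openin_topspace[of X] l unfolding \<B>'_def by blast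
    have cnt: "countable \<B>'" using \<B>(1) unfolding \<B>'_def by simp
    define B where "B = from_nat_into \<B>'"
    have B: "openin X (B i)" "l \<in> B i" for i
    proof -
      have "B i \<in> \<B>'" unfolding B_def by (rule from_nat_into[OF ne])
      then show "openin X (B i)" "l \<in> B i" using \<B>(2) unfolding \<B>'_def by simp_all
    qed
    \<comment> \<open>A decreasing neighborhood base of \<open>l\<close>.\<close>
    define V where "V n = (\<Inter>i\<in>{..n}. B i)" for n
    have V: "openin X (V n)" "l \<in> V n" for n
      unfolding V_def using B by (auto intro: openin_INT2)
    have "\<exists>r. \<forall>n. (r n \<in> pos_ints \<and> x (r n) \<in> V n) \<and> r n < r (Suc n)"
    proof (rule dependent_nat_choice)
      show "\<exists>k. k \<in> pos_ints \<and> x k \<in> V 0"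
        using not_finite_existsD[OF inf[OF V(1,2)]] .
    next
      fix k n
      have "\<exists>k'>k. k' \<in> {i \<in> pos_ints. x i \<in> V (Suc n)}"
        using inf[OF V(1,2)] unfolding infinite_nat_iff_unbounded by (rule spec)
      then show "\<exists>k'. (k' \<in> pos_ints \<and> x k' \<in> V (Suc n)) \<and> k < k'" by auto
    qed
    then obtain r where r: "\<And>n. r n \<in> pos_ints" "\<And>n. x (r n) \<in> V n" "\<And>n. r n < r (Suc n)"
      by metis
    have "limitin X (x \<circ> r) l sequentially"
      unfolding limitin_def eventually_sequentially
    proof (intro conjI allI impI l)
      fix U assume U: "openin X U \<and> l \<in> U"
      then obtain W where W: "W \<in> \<B>'" "W \<subseteq> U" using base unfolding \<B>'_def by blast
      obtain i where i: "B i = W" using from_nat_into_surj[OF cnt W(1)] unfolding B_def by blast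
      have "(x \<circ> r) n \<in> U" if "i \<le> n" for n
        using r(2)[of n] that W(2) i unfolding V_def by auto
      then show "\<exists>N. \<forall>n\<ge>N. (x \<circ> r) n \<in> U" by blast
    qed
    moreover have "strict_mono r" using r(3) by (simp add: strict_mono_Suc_iff)
    moreover have "range r \<subseteq> pos_ints" using r(1) by (rule image_subsetI)
    ultimately show "l \<in> ordinary_limit_points X x"
      unfolding ordinary_limit_points_def using l by blast
  qed
qed

lemma ideal_cluster_points_subset_limit_points:
  assumes "first_countable X" "ideal_on_pos_ints \<I>"
  shows "ideal_cluster_points X \<I> x \<subseteq> ordinary_limit_points X x"
proof
  fix l assume l: "l \<in> ideal_cluster_points X \<I> x"
  have "infinite {n \<in> pos_ints. x n \<in> U}" if "openin X U" "l \<in> U" for U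
  proof
    assume "finite {n \<in> pos_ints. x n \<in> U}"
    then have "{n \<in> pos_ints. x n \<in> U} \<in> \<I>" by (rule ideal_finite[OF assms(2)]) blast
    with l that show False unfolding ideal_cluster_points_def by blast
  qed
  with l show "l \<in> ordinary_limit_points X x"
    unfolding ordinary_limit_points_eq[OF assms(1)] ideal_cluster_points_def by blast
qed

lemma closedin_ideal_cluster_points: "closedin X (ideal_cluster_points X \<I> x)"
  unfolding closedin_def
proof
  show "ideal_cluster_points X \<I> x \<subseteq> topspace X" unfolding ideal_cluster_points_def by blast
  have "topspace X - ideal_cluster_points X \<I> x =
      \<Union>{U. openin X U \<and> {n \<in> pos_ints. x n \<in> U} \<in> \<I>}"
    unfolding ideal_cluster_points_def using openin_subset by fast
  then show "openin X (topspace X - ideal_cluster_points X \<I> x)" by auto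
qed

text \<open>A neighborhood that contains only finitely many terms of \<open>x\<close> contains only finitely many terms of
any subsequence.\<close>

lemma ideal_cluster_points_dyadic_subseq_subset:
  assumes X: "first_countable X" and ideal: "ideal_on_pos_ints \<I>" and \<omega>: "\<omega> \<in> {0<..1}"
  shows "ideal_cluster_points X \<I> (dyadic_subseq x \<omega>) \<subseteq> ordinary_limit_points X x"
proof
  fix l assume l: "l \<in> ideal_cluster_points X \<I> (dyadic_subseq x \<omega>)"
  have "infinite {n \<in> pos_ints. x n \<in> U}" if "openin X U" "l \<in> U" for U
  proof
    assume "finite {n \<in> pos_ints. x n \<in> U}"
    then have "finite {k \<in> pos_ints. dyadic_subseq x \<omega> k \<in> U}"
      unfolding dyadic_subseq_indices[OF \<omega>]
      by (rule finite_indices_in[OF infinite_dyadic_support[OF \<omega>]])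
    then have "{k \<in> pos_ints. dyadic_subseq x \<omega> k \<in> U} \<in> \<I>"
      by (rule ideal_finite[OF ideal]) blast
    with l that show False unfolding ideal_cluster_points_def by blast
  qed
  with l show "l \<in> ordinary_limit_points X x"
    unfolding ordinary_limit_points_eq[OF X] ideal_cluster_points_def by blast
qed

text \<open>If \<open>l\<close> is not a cluster point of the subsequence, this is witnessed by a member \<open>V\<close> of a countable
base at \<open>l\<close>. The set of \<open>n\<close> with \<open>x n \<in> V\<close> is infinite because \<open>l\<close> is a limit point of \<open>x\<close>, so each
of these countably many exceptional sets is meager.\<close>

lemma meager_limit_point_not_cluster:
  assumes X: "first_countable X" and ideal: "ideal_on_pos_ints \<I>" and sep: "fsigma_separated \<I>"
    and l: "l \<in> ordinary_limit_points X x"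
  shows "meager_in (top_of_set {0<..1})
    {\<omega> \<in> {0<..1}. l \<notin> ideal_cluster_points X \<I> (dyadic_subseq x \<omega>)}"
proof -
  have lX: "l \<in> topspace X"
    and inf: "\<And>U. openin X U \<Longrightarrow> l \<in> U \<Longrightarrow> infinite {n \<in> pos_ints. x n \<in> U}"
    using l unfolding ordinary_limit_points_eq[OF X] by blast+
  obtain \<B> where \<B>: "countable \<B>" "\<forall>V\<in>\<B>. openin X V"
    and base: "\<forall>U. openin X U \<and> l \<in> U \<longrightarrow> (\<exists>V\<in>\<B>. l \<in> V \<and> V \<subseteq> U)"
    using bspec[OF X[unfolded first_countable_def] lX] by (elim exE conjE)
  let ?bad = "\<lambda>V. {\<omega> \<in> {0<..1}. indices_in {n \<in> pos_ints. x n \<in> V} (dyadic_support \<omega>) \<in> \<I>}"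
  have "meager_in (top_of_set {0<..1}) (\<Union>V\<in>{V \<in> \<B>. l \<in> V}. ?bad V)"
  proof (rule meager_in_UN)
    show "countable {V \<in> \<B>. l \<in> V}" using \<B>(1) by simp
    fix V assume "V \<in> {V \<in> \<B>. l \<in> V}"
    then have "infinite {n \<in> pos_ints. x n \<in> V}" using inf \<B>(2) by blast
    then show "meager_in (top_of_set {0<..1}) (?bad V)"
      by (rule meager_indices_in_ideal[OF ideal sep]) blast
  qed
  then show ?thesis
  proof (rule meager_in_subset)
    show "{\<omega> \<in> {0<..1}. l \<notin> ideal_cluster_points X \<I> (dyadic_subseq x \<omega>)} \<subseteq>
        (\<Union>V\<in>{V \<in> \<B>. l \<in> V}. ?bad V)"
    proof
      fix \<omega> assume "\<omega> \<in> {\<omega> \<in> {0<..1}. l \<notin> ideal_cluster_points X \<I> (dyadic_subseq x \<omega>)}"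
      then have \<omega>: "\<omega> \<in> {0<..1}" and nl: "l \<notin> ideal_cluster_points X \<I> (dyadic_subseq x \<omega>)"
        by blast+
      obtain U where U: "openin X U" "l \<in> U"
        and UI: "{k \<in> pos_ints. dyadic_subseq x \<omega> k \<in> U} \<in> \<I>"
        using nl lX unfolding ideal_cluster_points_def by blast
      obtain V where V: "V \<in> \<B>" "l \<in> V" "V \<subseteq> U" using base U by blast
      have "{k \<in> pos_ints. dyadic_subseq x \<omega> k \<in> V} \<in> \<I>"
        by (rule ideal_subset[OF ideal UI]) (use V(3) in blast)
      then have "\<omega> \<in> ?bad V" using \<omega> unfolding dyadic_subseq_indices[OF \<omega>] by simp
      then show "\<omega> \<in> (\<Union>V\<in>{V \<in> \<B>. l \<in> V}. ?bad V)" using V(1,2) by blast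
    qed
  qed
qed

section \<open>The category dichotomy\<close>

theorem theorem2p1:
  fixes X :: "'a topology" and x :: "nat \<Rightarrow> 'a" and \<I> :: "nat set set"
  assumes "first_countable X"
    and "\<And>C. closedin X C \<Longrightarrow> separable_space (subtopology X C)"
    and "\<And>n. n \<in> pos_ints \<Longrightarrow> x n \<in> topspace X"
    and "ideal_on_pos_ints \<I>"
  shows "(fsigma_separated \<I> \<longrightarrow>
            (\<not> meager_in (top_of_set {0<..1})
                  {\<omega> \<in> {0<..1}. ideal_cluster_points X \<I> (dyadic_subseq x \<omega>) = ideal_cluster_points X \<I> x} \<longleftrightarrow>
               ideal_cluster_points X \<I> x = ordinary_limit_points X x) \<and>
            (ideal_cluster_points X \<I> x = ordinary_limit_points X x \<longrightarrow>
               comeager_in (top_of_set {0<..1})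
                  {\<omega> \<in> {0<..1}. ideal_cluster_points X \<I> (dyadic_subseq x \<omega>) = ideal_cluster_points X \<I> x})) \<and>
         (fsigma_delta_in cantor_powerset \<I> \<longrightarrow> fsigma_separated \<I>)"
proof (intro conjI impI)
  let ?\<Gamma> = "ideal_cluster_points X \<I> x"
  let ?\<Gamma>s = "\<lambda>\<omega>. ideal_cluster_points X \<I> (dyadic_subseq x \<omega>)"
  let ?G = "{\<omega> \<in> {0<..1}. ?\<Gamma>s \<omega> = ?\<Gamma>}"
  assume sep: "fsigma_separated \<I>"
  note limit_not_cluster = meager_limit_point_not_cluster[OF assms(1,4) sep]
  show comeager: "comeager_in (top_of_set {0<..1}) ?G"
    if eq: "?\<Gamma> = ordinary_limit_points X x"
  proof -
    \<comment> \<open>Only countably many points have to be treated: the set of cluster points of each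
  subsequence is closed, so it contains all of \<open>?\<Gamma>\<close> as soon as it contains a dense part of it.\<close>
    have "separable_space (subtopology X ?\<Gamma>)"
      by (rule assms(2)[OF closedin_ideal_cluster_points])
    then obtain D where D: "countable D" "D \<subseteq> ?\<Gamma>"
      and dense: "subtopology X ?\<Gamma> closure_of D = topspace (subtopology X ?\<Gamma>)"
      unfolding separable_space_def by auto
    have "?\<Gamma> \<subseteq> X closure_of D"
    proof -
      have "topspace (subtopology X ?\<Gamma>) = ?\<Gamma>"
        using closedin_subset[OF closedin_ideal_cluster_points] by (rule topspace_subtopology_subset)
      then show ?thesis using closure_of_subtopology_subset[of X ?\<Gamma> D] dense by simp
    qed
    have "meager_in (top_of_set {0<..1}) (\<Union>l\<in>D. {\<omega> \<in> {0<..1}. l \<notin> ?\<Gamma>s \<omega>})"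
      using D(1)
    proof (rule meager_in_UN)
      fix l assume "l \<in> D"
      then have "l \<in> ordinary_limit_points X x" using D(2) eq by blast
      then show "meager_in (top_of_set {0<..1}) {\<omega> \<in> {0<..1}. l \<notin> ?\<Gamma>s \<omega>}"
        by (rule limit_not_cluster)
    qed
    moreover have "{0<..1} - ?G \<subseteq> (\<Union>l\<in>D. {\<omega> \<in> {0<..1}. l \<notin> ?\<Gamma>s \<omega>})"
    proof (rule subsetI, rule ccontr)
      fix \<omega> assume "\<omega> \<in> {0<..1} - ?G" "\<omega> \<notin> (\<Union>l\<in>D. {\<omega> \<in> {0<..1}. l \<notin> ?\<Gamma>s \<omega>})"
      then have \<omega>: "\<omega> \<in> {0<..1}" and ne: "?\<Gamma>s \<omega> \<noteq> ?\<Gamma>" and D\<omega>: "D \<subseteq> ?\<Gamma>s \<omega>" by blast+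
      have "X closure_of D \<subseteq> ?\<Gamma>s \<omega>"
        by (rule closure_of_minimal[OF D\<omega> closedin_ideal_cluster_points])
      then have "?\<Gamma> \<subseteq> ?\<Gamma>s \<omega>" using \<open>?\<Gamma> \<subseteq> X closure_of D\<close> by (rule subset_trans[rotated])
      moreover have "?\<Gamma>s \<omega> \<subseteq> ?\<Gamma>"
        unfolding eq by (rule ideal_cluster_points_dyadic_subseq_subset[OF assms(1,4) \<omega>])
      ultimately show False using ne by (simp add: subset_antisym)
    qed
    ultimately have "meager_in (top_of_set {0<..1}) ({0<..1} - ?G)" by (rule meager_in_subset)
    then show ?thesis unfolding comeager_in_def by auto
  qed
  show "\<not> meager_in (top_of_set {0<..1}) ?G \<longleftrightarrow> ?\<Gamma> = ordinary_limit_points X x"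
  proof
    assume "?\<Gamma> = ordinary_limit_points X x"
    then have co: "meager_in (top_of_set {0<..1}) ({0<..1} - ?G)"
      using comeager unfolding comeager_in_def by simp
    show "\<not> meager_in (top_of_set {0<..1}) ?G"
    proof
      assume "meager_in (top_of_set {0<..1}) ?G"
      with co have "meager_in (top_of_set {0<..1}) (({0<..1} - ?G) \<union> ?G)"
        unfolding meager_in_def by (rule countable_union_of_Un)
      then have "meager_in (top_of_set {0<..1}) {0<..1::real}" by (rule meager_in_subset) blast
      with unit_interval_not_meager show False ..
    qed
  next
    assume nonmeager: "\<not> meager_in (top_of_set {0<..1}) ?G"
    show "?\<Gamma> = ordinary_limit_points X x"
    proof
      show "?\<Gamma> \<subseteq> ordinary_limit_points X x"
        by (rule ideal_cluster_points_subset_limit_points[OF assms(1,4)])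
      show "ordinary_limit_points X x \<subseteq> ?\<Gamma>"
      proof
        fix l assume "l \<in> ordinary_limit_points X x"
        then have "meager_in (top_of_set {0<..1}) {\<omega> \<in> {0<..1}. l \<notin> ?\<Gamma>s \<omega>}"
          by (rule limit_not_cluster)
        then have "\<not> ?G \<subseteq> {\<omega> \<in> {0<..1}. l \<notin> ?\<Gamma>s \<omega>}" using nonmeager meager_in_subset by blast
        then show "l \<in> ?\<Gamma>" by blast
      qed
    qed
  qed
next
  assume "fsigma_delta_in cantor_powerset \<I>"
  then show "fsigma_separated \<I>" by (rule fsigma_delta_ideal_separated[OF assms(4)])
qed

end
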